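(* Let $H\ge 4$ be an integer, $V_\beta$ a known symmetric positive-definite $H\times H$ matrix, and $\alpha\in(0,1)$. Let $\mathcal{M}$ be a finite nonempty pre-specified (non-random) universe of models of the types described in the context, with associated matrices $P(M)$, $M\in\mathcal{M}$. For any treatment path $\beta\in\mathbb{R}^H$, if $\hat\beta\sim N(\beta,V_\beta)$, $\hat M=\hat M(\hat\beta)\in\mathcal{M}$ is the data-dependent selected model, $\beta_{\hat M}=P(\hat M)\beta$ is the corresponding surrogate path, and $CR^{POSI}$ denotes the restricted plausible bounds (all defined in the context), then $$\mathbb{P}\left[\beta_{\hat M}\in CR^{POSI}\right]\ \ge\ 1-\alpha .$$
   Context: **Setup.** $\beta\in\mathbb{R}^H$ is the true treatment effect path, and $\hat\beta\sim N(\beta,V_\beta)$ its estimate. Write $V_\beta=\sigma^2V$ with $\sigma^2=\frac1H\sum_{h=1}^HV_\beta(h,h)$; here $A(i,j)$ denotes the $(i,j)$ entry of a matrix $A$. **Difference operators and weights.** $D_1$ is the $(H-1)\times H$ first-difference matrix and $D_3$ the $(H-3)\times H$ third-difference matrix. Let $V_1=D_1VD_1'$, $V_3=D_3VD_3'$. For $K\in\{1,\dots,H\}$ let $V_1(K)$ be the lower-right $(H-K)\times(H-K)$ block of $V_1$ (rows and columns $K,\dots,H-1$), $\bar V_1(K)=\frac{1}{H-K}\sum_{h=K}^{H-1}V_1(h,h)$, and $\bar V_3=\frac1{H-3}\sum_{h=1}^{H-3}V_3(h,h)$. For a square matrix $A$, $\mathrm{diag}(A)$ is the diagonal matrix with the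 same diagonal as $A$. Let $W_1(K)$ be the $(H-1)\times(H-1)$ block-diagonal matrix with upper-left block $\mathbf{0}_{(K-1)\times(K-1)}$ and lower-right block $\mathrm{diag}(V_1(K))/\bar V_1(K)$ (so $W_1(H)=0$), and $W_3=\mathrm{diag}(V_3)/\bar V_3$. **Model universe.** $\mathcal{M}$ is a finite nonempty set, fixed in advance and not depending on $\hat\beta$. Each $M\in\mathcal{M}$ is of one of the following types and has an associated $H\times H$ matrix $P(M)$: - $M=(\lambda_1,\lambda_2,K)$ with $\lambda_1,\lambda_2\ge0$, $K\in\{1,\dots,H\}$, and $$P(M)=\left(V^{-1}+\lambda_1D_1'W_1(K)D_1+\lambda_2D_3'W_3D_3\right)^{-1}V^{-1};$$ - a constant, linear, quadratic or cubic model (polynomial of degree $p\in\{0,1,2,3\}$ in $h$), with $P(M)=X(X'V^{-1}X)^{-1}X'V^{-1}$, where $X$ is the $H\times(p+1)$ matrix with rows $(1,h,\dots,h^p)$, $h=1,\dots,H$; - the unrestricted model, with $P(M)=I_H$. For $M\in\mathcal{M}$ let $\tilde\beta(M)=P(M)\hat\beta$ (the restricted estimate under $M$), $\beta_M=P(M)\beta$ (the surrogate path), $V_M=P(M)V_\beta P(M)'$, and $\mathrm{df}(M)=\mathrm{trace}(P(M))$. **Model selection.** $$\hat M\in\arg\min_{M\in\mathcal{M}}\ (\hat\beta-\tilde\beta(M))'V_\beta^{-1}(\hat\beta-\tilde\beta(M))+\log(H)\,\mathrm{df}(M),$$ with ties broken by any fixed measurable rule. **PoSI constant.** For $M\in\mathcal{M}$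 and $h=1,\dots,H$ let $$t_{h\cdot M}=V_M(h,h)^{-1/2}\,\big(P(M)(\hat\beta-\beta)\big)_h ,$$ so that for each $M$ the vector $P(M)(\hat\beta-\beta)$ is $N(\mathbf{0}_H,V_M)$. $C^\alpha$ is the minimal value satisfying $$\mathbb{P}\left(\max_{M\in\mathcal{M}}\max_{1\le h\le H}|t_{h\cdot M}|\le C^\alpha\right)\ge1-\alpha .$$ **Restricted plausible bounds.** $CR^{POSI}$ is the rectangular region $$CR^{POSI}=\prod_{h=1}^H\left[\tilde\beta(\hat M)_h-C^\alpha V_{\hat M}(h,h)^{1/2},\ \tilde\beta(\hat M)_h+C^\alpha V_{\hat M}(h,h)^{1/2}\right].$$ *)

theory Defs
  imports
    "HOL-Probability.Probability"
    "Jordan_Normal_Form.Gauss_Jordan_Elimination"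
begin

unbundle no inner_syntax
unbundle no vec_syntax
hide_const (open) Finite_Cartesian_Product.vec Finite_Cartesian_Product.mat
  Finite_Cartesian_Product.row Finite_Cartesian_Product.transpose
hide_type (open) Finite_Cartesian_Product.vec

text \<open>
  Vectors and matrices are indexed from 0: horizon \<open>h = 1, \<dots>, H\<close> is index \<open>h - 1\<close>.
\<close>

definition symmetric_mat :: "real mat \<Rightarrow> bool" where
  "symmetric_mat A \<longleftrightarrow> transpose_mat A = A"

definition pos_def_mat :: "nat \<Rightarrow> real mat \<Rightarrow> bool" where
  "pos_def_mat n A \<longleftrightarrow> (\<forall>x \<in> carrier_vec n. x \<noteq> 0\<^sub>v n \<longrightarrow> x \<bullet> (A *\<^sub>v x) > 0)"

text \<open>Unspecified on singular matrices, where \<open>mat_inverse\<close> is \<open>None\<close>.\<close>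
definition inv_mat :: "real mat \<Rightarrow> real mat" where
  "inv_mat A = the (mat_inverse A)"

definition trace_mat :: "real mat \<Rightarrow> real" where
  "trace_mat A = sum_list (diag_mat A)"

definition diag_part :: "real mat \<Rightarrow> real mat" where
  "diag_part A = mat_diag (dim_row A) (\<lambda>i. A $$ (i, i))"

definition diff_mat :: "nat \<Rightarrow> real mat" where
  "diff_mat n = mat (n - 1) n (\<lambda>(i, j). if j = i + 1 then 1 else if j = i then - 1 else 0)"

definition D1 :: "nat \<Rightarrow> real mat" where
  "D1 H = diff_mat H"

definition D3 :: "nat \<Rightarrow> real mat" where
  "D3 H = diff_mat (H - 2) * diff_mat (H - 1) * diff_mat H"

definition sigma2 :: "nat \<Rightarrow> real mat \<Rightarrow> real" where
  "sigma2 H V\<beta> = (\<Sum>h<H. V\<beta> $$ (h, h)) / real H"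

definition Vnorm :: "nat \<Rightarrow> real mat \<Rightarrow> real mat" where
  "Vnorm H V\<beta> = (1 / sigma2 H V\<beta>) \<cdot>\<^sub>m V\<beta>"

definition V1 :: "nat \<Rightarrow> real mat \<Rightarrow> real mat" where
  "V1 H V = D1 H * V * transpose_mat (D1 H)"

definition V3 :: "nat \<Rightarrow> real mat \<Rightarrow> real mat" where
  "V3 H V = D3 H * V * transpose_mat (D3 H)"

text \<open>Rows and columns \<open>K, \<dots>, H - 1\<close> of \<open>V1\<close>, counted from 1.\<close>
definition V1_block :: "nat \<Rightarrow> real mat \<Rightarrow> nat \<Rightarrow> real mat" where
  "V1_block H V K = mat (H - K) (H - K) (\<lambda>(i, j). V1 H V $$ (i + (K - 1), j + (K - 1)))"

definition V1_bar :: "nat \<Rightarrow> real mat \<Rightarrow> nat \<Rightarrow> real" where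
  "V1_bar H V K = (\<Sum>h = K..H - 1. V1 H V $$ (h - 1, h - 1)) / real (H - K)"

definition V3_bar :: "nat \<Rightarrow> real mat \<Rightarrow> real" where
  "V3_bar H V = (\<Sum>h = 1..H - 3. V3 H V $$ (h - 1, h - 1)) / real (H - 3)"

text \<open>For \<open>K = H\<close> the lower-right block is \<open>0 \<times> 0\<close>, and \<open>W1 H V H\<close> is the zero matrix.\<close>
definition W1 :: "nat \<Rightarrow> real mat \<Rightarrow> nat \<Rightarrow> real mat" where
  "W1 H V K = four_block_mat
     (0\<^sub>m (K - 1) (K - 1)) (0\<^sub>m (K - 1) (H - K))
     (0\<^sub>m (H - K) (K - 1)) ((1 / V1_bar H V K) \<cdot>\<^sub>m diag_part (V1_block H V K))"

definition W3 :: "nat \<Rightarrow> real mat \<Rightarrow> real mat" where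
  "W3 H V = (1 / V3_bar H V) \<cdot>\<^sub>m diag_part (V3 H V)"

datatype model =
    Smooth real real nat
  | Polynomial nat
  | Unrestricted

fun admissible :: "nat \<Rightarrow> model \<Rightarrow> bool" where
  "admissible H (Smooth l1 l2 K) \<longleftrightarrow> 0 \<le> l1 \<and> 0 \<le> l2 \<and> K \<in> {1..H}"
| "admissible H (Polynomial p) \<longleftrightarrow> p \<in> {0, 1, 2, 3}"
| "admissible H Unrestricted \<longleftrightarrow> True"

definition poly_design :: "nat \<Rightarrow> nat \<Rightarrow> real mat" where
  "poly_design H p = mat H (p + 1) (\<lambda>(i, j). real (i + 1) ^ j)"

fun model_mat :: "nat \<Rightarrow> real mat \<Rightarrow> model \<Rightarrow> real mat" where
  "model_mat H V (Smooth l1 l2 K) =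
     inv_mat (inv_mat V
       + l1 \<cdot>\<^sub>m (transpose_mat (D1 H) * W1 H V K * D1 H)
       + l2 \<cdot>\<^sub>m (transpose_mat (D3 H) * W3 H V * D3 H)) * inv_mat V"
| "model_mat H V (Polynomial p) =
     (let X = poly_design H p in
       X * inv_mat (transpose_mat X * inv_mat V * X) * transpose_mat X * inv_mat V)"
| "model_mat H V Unrestricted = 1\<^sub>m H"

definition P_mat :: "nat \<Rightarrow> real mat \<Rightarrow> model \<Rightarrow> real mat" where
  "P_mat H V\<beta> M = model_mat H (Vnorm H V\<beta>) M"

definition restricted_estimate :: "nat \<Rightarrow> real mat \<Rightarrow> model \<Rightarrow> real vec \<Rightarrow> real vec" where
  "restricted_estimate H V\<beta> M b = P_mat H V\<beta> M *\<^sub>v b"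

definition surrogate :: "nat \<Rightarrow> real mat \<Rightarrow> model \<Rightarrow> real vec \<Rightarrow> real vec" where
  "surrogate H V\<beta> M \<beta> = P_mat H V\<beta> M *\<^sub>v \<beta>"

definition V_M :: "nat \<Rightarrow> real mat \<Rightarrow> model \<Rightarrow> real mat" where
  "V_M H V\<beta> M = P_mat H V\<beta> M * V\<beta> * transpose_mat (P_mat H V\<beta> M)"

definition df :: "nat \<Rightarrow> real mat \<Rightarrow> model \<Rightarrow> real" where
  "df H V\<beta> M = trace_mat (P_mat H V\<beta> M)"

text \<open>The Borel \<open>\<sigma>\<close>-algebra on \<open>carrier_vec n\<close>, i.e. the one generated by the coordinates.\<close>
definition borel_vec :: "nat \<Rightarrow> real vec measure" where
  "borel_vec n = vimage_algebra (carrier_vec n) (\<lambda>x. \<lambda>i\<in>{..<n}. x $ i)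
     (\<Pi>\<^sub>M i\<in>{..<n}. borel)"

definition normal_law :: "real \<Rightarrow> real \<Rightarrow> real measure" where
  "normal_law m v =
     (if v = 0 then return borel m else density lborel (normal_density m (sqrt v)))"

text \<open>
  \<open>X\<close> has law \<open>N(\<mu>, S)\<close> iff every linear form \<open>a \<bullet> X\<close> has law \<open>N(a \<bullet> \<mu>, a \<bullet> S a)\<close>. This covers
  singular \<open>S\<close>, which occurs for the vectors \<open>P(M) (b - \<beta>)\<close>.
\<close>
definition normal_vec ::
  "'w measure \<Rightarrow> nat \<Rightarrow> ('w \<Rightarrow> real vec) \<Rightarrow> real vec \<Rightarrow> real mat \<Rightarrow> bool" where
  "normal_vec \<Omega> n X \<mu> S \<longleftrightarrow>
     X \<in> measurable \<Omega> (borel_vec n) \<and>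
     (\<forall>a \<in> carrier_vec n.
        distr \<Omega> borel (\<lambda>\<omega>. a \<bullet> X \<omega>) = normal_law (a \<bullet> \<mu>) (a \<bullet> (S *\<^sub>v a)))"

definition criterion :: "nat \<Rightarrow> real mat \<Rightarrow> real vec \<Rightarrow> model \<Rightarrow> real" where
  "criterion H V\<beta> b M =
     (b - restricted_estimate H V\<beta> M b) \<bullet>
       (inv_mat V\<beta> *\<^sub>v (b - restricted_estimate H V\<beta> M b))
     + ln (real H) * df H V\<beta> M"

text \<open>
  A selection rule is a function of the estimate; how it picks among several minimisers is
  arbitrary as long as the rule is measurable.
\<close>
definition selection_rule ::
  "nat \<Rightarrow> real mat \<Rightarrow> model set \<Rightarrow> (real vec \<Rightarrow> model) \<Rightarrow> bool" where
  "selection_rule H V\<beta> \<M> sel \<longleftrightarrow>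
     sel \<in> measurable (borel_vec H) (count_space \<M>) \<and>
     (\<forall>b \<in> carrier_vec H. is_arg_min (criterion H V\<beta> b) (\<lambda>M. M \<in> \<M>) (sel b))"

definition t_stat :: "nat \<Rightarrow> real mat \<Rightarrow> real vec \<Rightarrow> real vec \<Rightarrow> model \<Rightarrow> nat \<Rightarrow> real" where
  "t_stat H V\<beta> \<beta> b M h =
     ((P_mat H V\<beta> M *\<^sub>v (b - \<beta>)) $ h) / sqrt (V_M H V\<beta> M $$ (h, h))"

definition posi_const ::
  "'w measure \<Rightarrow> nat \<Rightarrow> real mat \<Rightarrow> model set \<Rightarrow> real \<Rightarrow> real vec \<Rightarrow> ('w \<Rightarrow> real vec) \<Rightarrow> real" where
  "posi_const \<Omega> H V\<beta> \<M> \<alpha> \<beta> X =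
     (LEAST c. measure \<Omega> {\<omega> \<in> space \<Omega>.
        (MAX M\<in>\<M>. MAX h\<in>{..<H}. \<bar>t_stat H V\<beta> \<beta> (X \<omega>) M h\<bar>) \<le> c} \<ge> 1 - \<alpha>)"

definition CR_posi ::
  "nat \<Rightarrow> real mat \<Rightarrow> (real vec \<Rightarrow> model) \<Rightarrow> real \<Rightarrow> real vec \<Rightarrow> real vec set" where
  "CR_posi H V\<beta> sel C b =
     (let M = sel b in
       {v \<in> carrier_vec H. \<forall>h<H. v $ h \<in>
          {restricted_estimate H V\<beta> M b $ h - C * sqrt (V_M H V\<beta> M $$ (h, h)) ..
           restricted_estimate H V\<beta> M b $ h + C * sqrt (V_M H V\<beta> M $$ (h, h))}})"

end

theory Submission
  imports Defs "Jordan_Normal_Form.Determinant"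
begin

text \<open>
  By linearity the surrogate path lies in the bounds with constant \<open>c\<close> exactly when every coordinate
  of the error \<open>P(M) (b - \<beta>)\<close> of the selected model \<open>M\<close> is at most \<open>c\<close> standard errors. The maximal
  \<open>t\<close>-statistic dominates these coordinates simultaneously over all models, so the event that it is
  at most \<open>C\<^sup>\<alpha>\<close> implies coverage whatever the selection rule does. The constant attains the level
  \<open>1 - \<alpha>\<close> because distribution functions are right-continuous.
\<close>

section \<open>Positive definite matrices\<close>

text \<open>Like \<open>pos_def_mat\<close>, a condition on the quadratic form alone, without
  symmetry. The penalties of the smooth models can only meet this weaker condition, since difference
  operators annihilate constant vectors.\<close>

definition pos_semidef_mat :: "nat \<Rightarrow> real mat \<Rightarrow> bool" where
  "pos_semidef_mat n A \<longleftrightarrow> (\<forall>x \<in> carrier_vec n. x \<bullet> (A *\<^sub>v x) \<ge> 0)"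

lemma scalar_prod_smult_mat_mult_vec:
  fixes A :: "real mat"
  assumes "A \<in> carrier_mat n n" "x \<in> carrier_vec n"
  shows "x \<bullet> ((k \<cdot>\<^sub>m A) *\<^sub>v x) = k * (x \<bullet> (A *\<^sub>v x))"
proof -
  have "(k \<cdot>\<^sub>m A) *\<^sub>v x = k \<cdot>\<^sub>v (A *\<^sub>v x)"
    using assms by (intro eq_vecI) auto
  then show ?thesis
    using assms by (simp add: scalar_prod_smult_distrib[of _ n])
qed

lemma scalar_prod_add_mat_mult_vec:
  fixes A B :: "real mat"
  assumes "A \<in> carrier_mat n n" "B \<in> carrier_mat n n" "x \<in> carrier_vec n"
  shows "x \<bullet> ((A + B) *\<^sub>v x) = x \<bullet> (A *\<^sub>v x) + x \<bullet> (B *\<^sub>v x)"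
  using assms by (simp add: add_mult_distrib_mat_vec[of _ n n] scalar_prod_add_distrib[of _ n])

lemma pos_def_imp_pos_semidef:
  assumes "A \<in> carrier_mat n n" "pos_def_mat n A"
  shows "pos_semidef_mat n A"
  unfolding pos_semidef_mat_def
proof
  fix x :: "real vec" assume x: "x \<in> carrier_vec n"
  show "0 \<le> x \<bullet> (A *\<^sub>v x)"
  proof (cases "x = 0\<^sub>v n")
    case True
    then show ?thesis using assms by (simp add: scalar_prod_left_zero[of _ n])
  next
    case False
    then show ?thesis using assms x unfolding pos_def_mat_def by (simp add: less_imp_le)
  qed
qed

lemma pos_def_smult:
  assumes "A \<in> carrier_mat n n" "pos_def_mat n A" "k > 0"
  shows "pos_def_mat n (k \<cdot>\<^sub>m A)"
  using assms unfolding pos_def_mat_def by (simp add: scalar_prod_smult_mat_mult_vec)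

lemma pos_semidef_smult:
  assumes "A \<in> carrier_mat n n" "pos_semidef_mat n A" "k \<ge> 0"
  shows "pos_semidef_mat n (k \<cdot>\<^sub>m A)"
  using assms unfolding pos_semidef_mat_def by (simp add: scalar_prod_smult_mat_mult_vec)

lemma pos_def_add_pos_semidef:
  assumes "A \<in> carrier_mat n n" "pos_def_mat n A"
    and "B \<in> carrier_mat n n" "pos_semidef_mat n B"
  shows "pos_def_mat n (A + B)"
  using assms unfolding pos_def_mat_def pos_semidef_mat_def
  by (simp add: scalar_prod_add_mat_mult_vec add_pos_nonneg)

lemma diagonal_pos_semidef:
  fixes D :: "real mat"
  assumes D: "D \<in> carrier_mat n n"
    and off: "\<And>i j. i < n \<Longrightarrow> j < n \<Longrightarrow> i \<noteq> j \<Longrightarrow> D $$ (i, j) = 0"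
    and nonneg: "\<And>i. i < n \<Longrightarrow> D $$ (i, i) \<ge> 0"
  shows "pos_semidef_mat n D"
  unfolding pos_semidef_mat_def
proof
  fix x :: "real vec" assume x: "x \<in> carrier_vec n"
  have "(D *\<^sub>v x) $ i = D $$ (i, i) * x $ i" if i: "i < n" for i
  proof -
    have "(D *\<^sub>v x) $ i = (\<Sum>j\<in>{0..<n}. D $$ (i, j) * x $ j)"
      using D x i by (auto simp: scalar_prod_def intro!: sum.cong)
    also have "\<dots> = (\<Sum>j\<in>{0..<n}. if j = i then D $$ (i, i) * x $ i else 0)"
      using off i by (intro sum.cong) auto
    finally show ?thesis using i by simp
  qed
  then have "x \<bullet> (D *\<^sub>v x) = (\<Sum>i\<in>{0..<n}. D $$ (i, i) * (x $ i)\<^sup>2)"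
    using D by (auto simp: scalar_prod_def power2_eq_square intro!: sum.cong)
  also have "\<dots> \<ge> 0"
    using nonneg by (intro sum_nonneg) auto
  finally show "0 \<le> x \<bullet> (D *\<^sub>v x)" .
qed

text \<open>The form of \<open>B' A B\<close> at \<open>x\<close> is the form of \<open>A\<close> at
  \<open>B x\<close>. The penalties \<open>D1' W1 D1\<close> and \<open>D3' W3 D3\<close> have this
  shape.\<close>

lemma pos_semidef_congruence:
  assumes A: "A \<in> carrier_mat m m" "pos_semidef_mat m A" and B: "B \<in> carrier_mat m n"
  shows "pos_semidef_mat n (transpose_mat B * A * B)"
  unfolding pos_semidef_mat_def
proof
  fix x :: "real vec" assume x: "x \<in> carrier_vec n"
  have "(transpose_mat B * A * B) *\<^sub>v x = transpose_mat B *\<^sub>v (A *\<^sub>v (B *\<^sub>v x))"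
    using A B x by (simp add: assoc_mult_mat_vec[of _ n m _ n] assoc_mult_mat_vec[of _ n m _ m])
  moreover have "x \<bullet> (transpose_mat B *\<^sub>v (A *\<^sub>v (B *\<^sub>v x))) = (A *\<^sub>v (B *\<^sub>v x)) \<bullet> (B *\<^sub>v x)"
    using A B x transpose_vec_mult_scalar[OF B x, of "A *\<^sub>v (B *\<^sub>v x)"]
    by (simp add: comm_scalar_prod[of x n])
  moreover have "\<dots> = (B *\<^sub>v x) \<bullet> (A *\<^sub>v (B *\<^sub>v x))"
    using A B x by (intro comm_scalar_prod[of _ m]) auto
  ultimately show "0 \<le> x \<bullet> ((transpose_mat B * A * B) *\<^sub>v x)"
    using A B x unfolding pos_semidef_mat_def by simp
qed

text \<open>Used in two roles: with a difference matrix for \<open>B\<close> it gives the diagonals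
  of \<open>V1\<close> and \<open>V3\<close>, from which the weights are built; with
  \<open>P(M)\<close> for \<open>B\<close> it gives the variance \<open>V_M(h, h)\<close> as a form
  in row \<open>h\<close> of \<open>P(M)\<close>.\<close>

lemma congruence_diag_entry:
  fixes A B :: "real mat"
  assumes A: "A \<in> carrier_mat n n" and B: "B \<in> carrier_mat m n" and i: "i < m"
  shows "(B * A * transpose_mat B) $$ (i, i) = row B i \<bullet> (A *\<^sub>v row B i)"
proof -
  have "B * A * transpose_mat B = B * (A * transpose_mat B)"
    using A B by (intro assoc_mult_mat) auto
  then have "(B * A * transpose_mat B) $$ (i, i) = row B i \<bullet> col (A * transpose_mat B) i"
    using A B i by simp
  moreover have "col (A * transpose_mat B) i = A *\<^sub>v row B i"
    using A B i by (intro eq_vecI) auto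
  ultimately show ?thesis by simp
qed

lemma congruence_diag_entry_nonneg:
  assumes "A \<in> carrier_mat n n" "pos_semidef_mat n A" "B \<in> carrier_mat m n" "i < m"
  shows "(B * A * transpose_mat B) $$ (i, i) \<ge> 0"
proof -
  have "row B i \<in> carrier_vec n"
    using assms by auto
  then show ?thesis
    using assms congruence_diag_entry[OF assms(1,3,4)] unfolding pos_semidef_mat_def by simp
qed

text \<open>If \<open>A v = 0\<close> then the form vanishes at \<open>v\<close>, so
  \<open>v = 0\<close>; a trivial kernel means a nonzero determinant. Hence
  \<open>mat_inverse\<close> succeeds and the unspecified value of \<open>inv_mat\<close> never
  arises.\<close>

lemma inv_mat_pos_def:
  assumes A: "A \<in> carrier_mat n n" "pos_def_mat n A"
  shows "A * inv_mat A = 1\<^sub>m n" "inv_mat A \<in> carrier_mat n n"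
proof -
  have "\<not> (\<exists>v. v \<in> carrier_vec n \<and> v \<noteq> 0\<^sub>v n \<and> A *\<^sub>v v = 0\<^sub>v n)"
    using A(2) unfolding pos_def_mat_def by fastforce
  then have "det A \<noteq> 0"
    using det_0_iff_vec_prod_zero_field[OF A(1)] by simp
  then have "A \<in> Units (ring_mat TYPE(real) n ())"
    using A(1) by (rule det_non_zero_imp_unit[rotated])
  then obtain B where "mat_inverse A = Some B"
    using mat_inverse(1)[OF A(1), where b = "()"] by (cases "mat_inverse A") auto
  then show "A * inv_mat A = 1\<^sub>m n" "inv_mat A \<in> carrier_mat n n"
    using mat_inverse(2)[OF A(1)] by (auto simp: inv_mat_def)
qed

text \<open>Substitute \<open>x = A y\<close>: the form of the inverse at \<open>x\<close> is the
  form of \<open>A\<close> at \<open>y\<close>, and \<open>y\<close> is nonzero because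
  \<open>x\<close> is.\<close>

lemma pos_def_inv_mat:
  assumes A: "A \<in> carrier_mat n n" "pos_def_mat n A"
  shows "pos_def_mat n (inv_mat A)"
  unfolding pos_def_mat_def
proof (intro ballI impI)
  fix x :: "real vec" assume x: "x \<in> carrier_vec n" "x \<noteq> 0\<^sub>v n"
  note inv = inv_mat_pos_def[OF A]
  let ?y = "inv_mat A *\<^sub>v x"
  have y: "?y \<in> carrier_vec n" using inv x by auto
  have Ay: "A *\<^sub>v ?y = x"
    using assoc_mult_mat_vec[OF A(1) inv(2) x(1)] inv(1) x by simp
  have "A *\<^sub>v 0\<^sub>v n = 0\<^sub>v n"
    using A(1) by (intro eq_vecI) (auto intro: scalar_prod_right_zero)
  with x Ay have "?y \<noteq> 0\<^sub>v n" by auto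
  then have "0 < ?y \<bullet> (A *\<^sub>v ?y)"
    using A(2) y unfolding pos_def_mat_def by simp
  also have "\<dots> = x \<bullet> ?y"
    using Ay x y by (simp add: comm_scalar_prod[of _ n])
  finally show "0 < x \<bullet> (inv_mat A *\<^sub>v x)" .
qed

section \<open>Model matrices\<close>

lemma diff_mat_carrier: "diff_mat n \<in> carrier_mat (n - 1) n"
  by (simp add: diff_mat_def)

lemma D1_carrier: "D1 H \<in> carrier_mat (H - 1) H"
  unfolding D1_def by (rule diff_mat_carrier)

lemma D3_carrier: "D3 H \<in> carrier_mat (H - 3) H"
  unfolding D3_def carrier_mat_def by (simp add: diff_mat_def)

lemma W1_carrier:
  assumes "K \<in> {1..H}"
  shows "W1 H V K \<in> carrier_mat (H - 1) (H - 1)"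
  using assms unfolding W1_def carrier_mat_def
  by (auto simp: diag_part_def V1_block_def mat_diag_def)

text \<open>Makes the diagonal shape of \<open>W1\<close> visible. The one-based first row
  \<open>K\<close> of the block is the zero-based index \<open>K - 1\<close>. For
  \<open>K = H\<close> no index reaches the block, so the entries are all 0, as they should
  be.\<close>

lemma W1_index:
  assumes "K \<in> {1..H}" "i < H - 1" "j < H - 1"
  shows "W1 H V K $$ (i, j) = (if i = j \<and> K - 1 \<le> i then V1 H V $$ (i, i) / V1_bar H V K else 0)"
proof -
  define k where "k = K - 1"
  define E where "E = (1 / V1_bar H V K) \<cdot>\<^sub>m diag_part (V1_block H V K)"
  have dims: "dim_row E = H - K" "dim_col E = H - K" and HK: "H - 1 = k + (H - K)"
    using assms by (auto simp: E_def k_def diag_part_def V1_block_def mat_diag_def)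
  have E: "E $$ (a, b) = (if a = b then V1 H V $$ (a + k, a + k) / V1_bar H V K else 0)"
    if "a < H - K" "b < H - K" for a b
    using that by (simp add: E_def k_def diag_part_def V1_block_def mat_diag_def)
  have W: "W1 H V K = four_block_mat (0\<^sub>m k k) (0\<^sub>m k (H - K)) (0\<^sub>m (H - K) k) E"
    unfolding W1_def E_def k_def ..
  have ij: "i < k + (H - K)" "j < k + (H - K)"
    using assms HK by simp_all
  show ?thesis
    unfolding W k_def[symmetric] using ij by (auto simp: dims E)
qed

text \<open>The weights are diagonal entries of a congruence of \<open>V\<close>, hence nonnegative,
  divided by their nonnegative mean. A vanishing mean, as for \<open>K = H\<close>, does no harm
  because \<open>x / 0 = 0\<close>.\<close>

lemma W1_pos_semidef:
  assumes V: "V \<in> carrier_mat H H" "pos_semidef_mat H V" and K: "K \<in> {1..H}"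
  shows "pos_semidef_mat (H - 1) (W1 H V K)"
proof (rule diagonal_pos_semidef[OF W1_carrier[OF K]])
  have V1: "V1 H V $$ (i, i) \<ge> 0" if "i < H - 1" for i
    unfolding V1_def using congruence_diag_entry_nonneg[OF V D1_carrier that] .
  then have "V1_bar H V K \<ge> 0"
    unfolding V1_bar_def using K by (intro divide_nonneg_nonneg sum_nonneg) auto
  then show "W1 H V K $$ (i, i) \<ge> 0" if "i < H - 1" for i
    using V1[OF that] by (simp add: W1_index[OF K that that])
  show "W1 H V K $$ (i, j) = 0" if "i < H - 1" "j < H - 1" "i \<noteq> j" for i j
    using that by (simp add: W1_index[OF K])
qed

lemma W3_carrier: "W3 H V \<in> carrier_mat (H - 3) (H - 3)"
  using D3_carrier[of H] by (auto simp: W3_def diag_part_def V3_def mat_diag_def)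

lemma W3_pos_semidef:
  assumes V: "V \<in> carrier_mat H H" "pos_semidef_mat H V"
  shows "pos_semidef_mat (H - 3) (W3 H V)"
proof (rule diagonal_pos_semidef[OF W3_carrier])
  have D3: "dim_row (D3 H) = H - 3"
    using D3_carrier[of H] by simp
  have V3: "V3 H V $$ (i, i) \<ge> 0" if "i < H - 3" for i
    unfolding V3_def using congruence_diag_entry_nonneg[OF V D3_carrier that] .
  then have "V3_bar H V \<ge> 0"
    unfolding V3_bar_def by (intro divide_nonneg_nonneg sum_nonneg) auto
  moreover have "dim_row (V3 H V) = H - 3"
    by (simp add: V3_def D3)
  ultimately show "W3 H V $$ (i, i) \<ge> 0" if "i < H - 3" for i
    using that V3 by (auto simp: W3_def diag_part_def mat_diag_def)
  show "W3 H V $$ (i, j) = 0" if "i < H - 3" "j < H - 3" "i \<noteq> j" for i j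
    using that D3 by (auto simp: W3_def diag_part_def mat_diag_def V3_def)
qed

text \<open>What coverage needs to know about \<open>P(M)\<close> is its shape. In the smooth case
  this requires the outer inverse to exist: its argument is the positive definite inverse of
  \<open>V\<close> plus nonnegative multiples of semidefinite penalties.\<close>

lemma model_mat_carrier:
  assumes V: "V \<in> carrier_mat H H" "pos_def_mat H V" and M: "admissible H M"
  shows "model_mat H V M \<in> carrier_mat H H"
proof (cases M)
  case (Smooth l1 l2 K)
  then have l: "l1 \<ge> 0" "l2 \<ge> 0" and K: "K \<in> {1..H}"
    using M by auto
  note Vi = inv_mat_pos_def(2)[OF V] and psd = pos_def_imp_pos_semidef[OF V]
  define A1 where "A1 = transpose_mat (D1 H) * W1 H V K * D1 H"
  define A3 where "A3 = transpose_mat (D3 H) * W3 H V * D3 H"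
  have A1: "A1 \<in> carrier_mat H H"
    unfolding A1_def by (intro mult_carrier_mat[of _ H "H - 1"])
      (use D1_carrier[of H] W1_carrier[OF K, of V] in simp_all)
  have A3: "A3 \<in> carrier_mat H H"
    unfolding A3_def by (intro mult_carrier_mat[of _ H "H - 3"])
      (use D3_carrier[of H] W3_carrier[of H V] in simp_all)
  have "pos_semidef_mat H A1"
    unfolding A1_def
    by (rule pos_semidef_congruence[OF W1_carrier[OF K] W1_pos_semidef[OF V(1) psd K] D1_carrier])
  then have "pos_def_mat H (inv_mat V + l1 \<cdot>\<^sub>m A1)"
    by (rule pos_def_add_pos_semidef[OF Vi pos_def_inv_mat[OF V] smult_carrier_mat[OF A1]
        pos_semidef_smult[OF A1 _ l(1)]])
  moreover have "pos_semidef_mat H A3"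
    unfolding A3_def
    by (rule pos_semidef_congruence[OF W3_carrier W3_pos_semidef[OF V(1) psd] D3_carrier])
  moreover have c: "inv_mat V + l1 \<cdot>\<^sub>m A1 \<in> carrier_mat H H"
    by (rule add_carrier_mat[OF smult_carrier_mat[OF A1]])
  ultimately have "pos_def_mat H (inv_mat V + l1 \<cdot>\<^sub>m A1 + l2 \<cdot>\<^sub>m A3)"
    by (intro pos_def_add_pos_semidef[OF c _ smult_carrier_mat[OF A3]]
        pos_semidef_smult[OF A3 _ l(2)])
  then have "inv_mat (inv_mat V + l1 \<cdot>\<^sub>m A1 + l2 \<cdot>\<^sub>m A3) * inv_mat V \<in> carrier_mat H H"
    by (intro mult_carrier_mat[OF _ Vi] inv_mat_pos_def(2)
        add_carrier_mat[OF smult_carrier_mat[OF A3]])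
  then show ?thesis
    unfolding Smooth A1_def A3_def by simp
next
  case (Polynomial p)
  \<comment> \<open>The dimensions of the product are read off its outer factors: the rows from the
    design matrix, the columns from the inverse of \<open>V\<close>.\<close>
  have "inv_mat V \<in> carrier_mat H H" by (rule inv_mat_pos_def(2)[OF V])
  moreover have "dim_row (poly_design H p) = H" by (simp add: poly_design_def)
  ultimately show ?thesis
    unfolding Polynomial model_mat.simps Let_def by (intro carrier_matI) simp_all
next
  case Unrestricted
  then show ?thesis by simp
qed

text \<open>A diagonal entry is the quadratic form at a unit vector, so the mean of the diagonal is
  positive. Dividing by it therefore keeps \<open>Vnorm\<close> positive definite.\<close>

lemma sigma2_pos:
  assumes V: "V\<beta> \<in> carrier_mat H H" "pos_def_mat H V\<beta>" and H: "H > 0"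
  shows "sigma2 H V\<beta> > 0"
proof -
  have "V\<beta> $$ (h, h) > 0" if h: "h < H" for h
  proof -
    have "unit_vec H h \<bullet> (V\<beta> *\<^sub>v unit_vec H h) = V\<beta> $$ (h, h)"
      using V h by (simp add: scalar_prod_left_unit scalar_prod_right_unit[of h H])
    moreover have "unit_vec H h \<noteq> (0\<^sub>v H :: real vec)"
      using h by (metis index_unit_vec(2) index_zero_vec(1) zero_neq_one)
    ultimately show ?thesis
      using V(2) unfolding pos_def_mat_def by (metis unit_vec_carrier)
  qed
  then show ?thesis
    unfolding sigma2_def using H by (intro divide_pos_pos sum_pos) auto
qed

lemma P_mat_carrier:
  assumes V: "V\<beta> \<in> carrier_mat H H" "pos_def_mat H V\<beta>" and "H > 0" and "admissible H M"
  shows "P_mat H V\<beta> M \<in> carrier_mat H H"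
  unfolding P_mat_def
proof (rule model_mat_carrier)
  show "Vnorm H V\<beta> \<in> carrier_mat H H"
    using V by (simp add: Vnorm_def)
  show "pos_def_mat H (Vnorm H V\<beta>)"
    unfolding Vnorm_def using pos_def_smult[OF V] sigma2_pos[OF assms(1-3)] by simp
qed fact

section \<open>Attainment of the critical value\<close>

text \<open>Over the reals \<open>LEAST\<close> is meaningful only if a minimum exists. The levels
  \<open>c\<close> with \<open>F c \<ge> p\<close> form a nonempty set because \<open>F\<close>
  tends to 1 > \<open>p\<close>, and it is bounded below because \<open>F\<close> tends to 0 <
  \<open>p\<close>. Right-continuity puts the infimum into the set.\<close>

lemma (in prob_space) prob_le_Least_quantile:
  fixes X :: "'a \<Rightarrow> real"
  assumes X[measurable]: "X \<in> borel_measurable M" and p: "0 < p" "p < 1"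
  shows "prob {\<omega> \<in> space M. X \<omega> \<le> (LEAST c. prob {\<omega> \<in> space M. X \<omega> \<le> c} \<ge> p)} \<ge> p"
proof -
  interpret D: real_distribution "distr M borel X"
    by (rule real_distribution_distr) simp
  define F where "F = cdf (distr M borel X)"
  have F: "prob {\<omega> \<in> space M. X \<omega> \<le> c} = F c" for c
    by (auto simp: F_def cdf_def measure_distr intro!: arg_cong[where f = prob])
  have mono: "F x \<le> F y" if "x \<le> y" for x y
    unfolding F_def using that by (rule D.cdf_nondecreasing)
  define S where "S = {c. F c \<ge> p}"
  have "\<forall>\<^sub>F c in at_top. F c > p"
    unfolding F_def using D.cdf_lim_at_top_prob p(2) by (rule order_tendstoD)
  then obtain c where "F c > p"
    by (auto simp: eventually_at_top_linorder)
  then have ne: "S \<noteq> {}"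
    by (auto simp: S_def intro: less_imp_le)
  have "\<forall>\<^sub>F c in at_bot. F c < p"
    unfolding F_def using D.cdf_lim_at_bot p(1) by (rule order_tendstoD)
  then obtain b where b: "F b < p"
    by (auto simp: eventually_at_bot_linorder)
  have bdd: "bdd_below S"
  proof (rule bdd_belowI)
    fix c assume "c \<in> S"
    then show "b \<le> c"
      using b mono[of c b] by (force simp: S_def)
  qed
  \<comment> \<open>A level above the infimum lies above some member of \<open>S\<close>, and
    \<open>F\<close> is monotone. This bounds \<open>F\<close> on a right neighbourhood, and the
    bound passes to the limit.\<close>
  have "F c \<ge> p" if c: "c > Inf S" for c
  proof -
    obtain s where "s \<in> S" "s < c"
      using cInf_lessD[OF ne c] by blast
    then show ?thesis
      using mono[of s c] by (simp add: S_def)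
  qed
  then have "\<forall>\<^sub>F c in at_right (Inf S). F c \<ge> p"
    by (auto simp: eventually_at_filter)
  moreover have "(F \<longlongrightarrow> F (Inf S)) (at_right (Inf S))"
    using D.cdf_is_right_cont unfolding F_def continuous_within .
  ultimately have attained: "F (Inf S) \<ge> p"
    by (intro tendsto_lowerbound) auto
  have "(LEAST c. F c \<ge> p) = Inf S"
    using attained bdd by (intro Least_equality cInf_lower) (auto simp: S_def)
  with attained show ?thesis
    by (simp add: F)
qed

section \<open>Coverage\<close>

text \<open>\<open>borel_vec\<close> is the pullback of the product algebra, so the map to
  coordinate tuples is measurable by construction; a projection is then composed with it.\<close>

lemma measurable_vec_index:
  assumes X: "X \<in> measurable \<Omega> (borel_vec n)" and i: "i < n"
  shows "(\<lambda>\<omega>. X \<omega> $ i) \<in> borel_measurable \<Omega>"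
proof -
  have "(\<lambda>x. \<lambda>i\<in>{..<n}. x $ i) \<in> measurable (borel_vec n) (\<Pi>\<^sub>M i\<in>{..<n}. (borel :: real measure))"
    unfolding borel_vec_def by (rule measurable_vimage_algebra1) (auto simp: space_PiM)
  then have "(\<lambda>x. (\<lambda>i\<in>{..<n}. x $ i) i) \<in> measurable (borel_vec n) (borel :: real measure)"
    by (rule measurable_compose) (use i in simp)
  then have "(\<lambda>x. x $ i) \<in> measurable (borel_vec n) (borel :: real measure)"
    using i by simp
  with X show ?thesis
    by (rule measurable_compose)
qed

lemma measurable_vec_carrier:
  assumes "X \<in> measurable \<Omega> (borel_vec n)" and "\<omega> \<in> space \<Omega>"
  shows "X \<omega> \<in> carrier_vec n"
  using measurable_space[OF assms] by (simp add: borel_vec_def)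

text \<open>An equivalence rather than an implication, because it serves both to bound the coverage
  event from below and to prove that it is measurable.\<close>

lemma surrogate_mem_CR_posi_iff:
  assumes P: "P_mat H V\<beta> (sel b) \<in> carrier_mat H H"
    and b: "b \<in> carrier_vec H" and \<beta>: "\<beta> \<in> carrier_vec H"
  shows "surrogate H V\<beta> (sel b) \<beta> \<in> CR_posi H V\<beta> sel C b \<longleftrightarrow>
    (\<forall>h<H. \<bar>(P_mat H V\<beta> (sel b) *\<^sub>v (b - \<beta>)) $ h\<bar> \<le> C * sqrt (V_M H V\<beta> (sel b) $$ (h, h)))"
proof -
  let ?P = "P_mat H V\<beta> (sel b)"
  have "(?P *\<^sub>v \<beta>) $ h \<in>
      {(?P *\<^sub>v b) $ h - C * s .. (?P *\<^sub>v b) $ h + C * s} \<longleftrightarrow>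
      \<bar>(?P *\<^sub>v (b - \<beta>)) $ h\<bar> \<le> C * s" if "h < H" for h s
  proof -
    have "(?P *\<^sub>v (b - \<beta>)) $ h = (?P *\<^sub>v b) $ h - (?P *\<^sub>v \<beta>) $ h"
      using mult_minus_distrib_mat_vec[OF P b \<beta>] P that by simp
    then show ?thesis
      unfolding atLeastAtMost_iff by linarith
  qed
  moreover have "?P *\<^sub>v \<beta> \<in> carrier_vec H"
    using P \<beta> by auto
  ultimately show ?thesis
    unfolding CR_posi_def Let_def surrogate_def restricted_estimate_def by blast
qed

text \<open>
  When \<open>V_M(h, h) = 0\<close> the statistic is \<open>0\<close> by the convention \<open>x / 0 = 0\<close>; the bound survives
  because row \<open>h\<close> of \<open>P(M)\<close> then vanishes.
\<close>
lemma abs_le_mult_sqrt_V_M: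
  assumes V: "V\<beta> \<in> carrier_mat H H" "pos_def_mat H V\<beta>"
    and P: "P_mat H V\<beta> M \<in> carrier_mat H H"
    and b: "b \<in> carrier_vec H" and \<beta>: "\<beta> \<in> carrier_vec H" and h: "h < H"
    and le: "\<bar>t_stat H V\<beta> \<beta> b M h\<bar> \<le> C"
  shows "\<bar>(P_mat H V\<beta> M *\<^sub>v (b - \<beta>)) $ h\<bar> \<le> C * sqrt (V_M H V\<beta> M $$ (h, h))"
proof -
  let ?r = "row (P_mat H V\<beta> M) h" and ?v = "V_M H V\<beta> M $$ (h, h)"
  have r: "?r \<in> carrier_vec H" using P h by auto
  have v: "?v = ?r \<bullet> (V\<beta> *\<^sub>v ?r)"
    unfolding V_M_def by (rule congruence_diag_entry[OF V(1) P h])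
  show ?thesis
  proof (cases "?r = 0\<^sub>v H")
    case True
    then have "?v = 0"
      using v V by (simp add: scalar_prod_left_zero[of _ H])
    moreover have "(P_mat H V\<beta> M *\<^sub>v (b - \<beta>)) $ h = 0"
      using True P h b \<beta> by (simp add: scalar_prod_left_zero[of _ H])
    ultimately show ?thesis by simp
  next
    case False
    then have "?v > 0"
      using V(2) r v unfolding pos_def_mat_def by simp
    then show ?thesis
      using le by (simp add: t_stat_def abs_divide pos_divide_le_eq)
  qed
qed

lemma measurable_mult_mat_vec_index:
  assumes X: "X \<in> measurable \<Omega> (borel_vec n)" and P: "P \<in> carrier_mat m n"
    and \<beta>: "\<beta> \<in> carrier_vec n" and h: "h < m"
  shows "(\<lambda>\<omega>. (P *\<^sub>v (X \<omega> - \<beta>)) $ h) \<in> borel_measurable \<Omega>"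
proof -
  note [measurable] = measurable_vec_index[OF X]
  \<comment> \<open>Valid for every \<omega>, since a difference of vectors takes its dimension from
    the second argument, here \<beta>.\<close>
  have "(P *\<^sub>v (X \<omega> - \<beta>)) $ h = (\<Sum>i\<in>{0..<n}. P $$ (h, i) * (X \<omega> $ i - \<beta> $ i))" for \<omega>
    using P \<beta> h by (auto simp: scalar_prod_def intro!: sum.cong)
  moreover have "(\<lambda>\<omega>. \<Sum>i\<in>{0..<n}. P $$ (h, i) * (X \<omega> $ i - \<beta> $ i)) \<in> borel_measurable \<Omega>"
    by (intro borel_measurable_sum) auto
  ultimately show ?thesis by simp
qed

theorem proposition2:
  fixes \<Omega> :: "'w measure" and H :: nat and V\<beta> :: "real mat" and \<alpha> :: real
    and \<M> :: "model set" and \<beta> :: "real vec" and \<beta>hat :: "'w \<Rightarrow> real vec"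
    and Mhat :: "real vec \<Rightarrow> model"
  assumes "prob_space \<Omega>"
    and "H \<ge> 4"
    and "V\<beta> \<in> carrier_mat H H" and "symmetric_mat V\<beta>" and "pos_def_mat H V\<beta>"
    and "0 < \<alpha>" and "\<alpha> < 1"
    and "finite \<M>" and "\<M> \<noteq> {}" and "\<forall>M \<in> \<M>. admissible H M"
    and "\<beta> \<in> carrier_vec H"
    and "normal_vec \<Omega> H \<beta>hat \<beta> V\<beta>"
    and "selection_rule H V\<beta> \<M> Mhat"
  shows "measure \<Omega> {\<omega> \<in> space \<Omega>.
           surrogate H V\<beta> (Mhat (\<beta>hat \<omega>)) \<beta>
             \<in> CR_posi H V\<beta> Mhat (posi_const \<Omega> H V\<beta> \<M> \<alpha> \<beta> \<beta>hat) (\<beta>hat \<omega>)} \<ge> 1 - \<alpha>"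
proof -
  interpret prob_space \<Omega> by fact
  note H = \<open>H \<ge> 4\<close> and V = \<open>V\<beta> \<in> carrier_mat H H\<close> \<open>pos_def_mat H V\<beta>\<close>
    and fin = \<open>finite \<M>\<close> and \<beta> = \<open>\<beta> \<in> carrier_vec H\<close>
  have X: "\<beta>hat \<in> measurable \<Omega> (borel_vec H)"
    using \<open>normal_vec \<Omega> H \<beta>hat \<beta> V\<beta>\<close> by (simp add: normal_vec_def)
  note carr = measurable_vec_carrier[OF X]
  have sel[measurable]: "(\<lambda>\<omega>. Mhat (\<beta>hat \<omega>)) \<in> measurable \<Omega> (count_space \<M>)"
    by (rule measurable_compose[OF X])
      (use \<open>selection_rule H V\<beta> \<M> Mhat\<close> in \<open>simp add: selection_rule_def\<close>)
  have selin: "Mhat (\<beta>hat \<omega>) \<in> \<M>" if "\<omega> \<in> space \<Omega>" for \<omega>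
    using measurable_space[OF sel that] by simp
  have P: "P_mat H V\<beta> M \<in> carrier_mat H H" if "M \<in> \<M>" for M
    using P_mat_carrier[OF V] H \<open>\<forall>M \<in> \<M>. admissible H M\<close> that by simp
  note Pm = measurable_mult_mat_vec_index[OF X P \<beta>]
  define T where "T = (\<lambda>\<omega>. MAX M\<in>\<M>. MAX h\<in>{..<H}. \<bar>t_stat H V\<beta> \<beta> (\<beta>hat \<omega>) M h\<bar>)"
  have "T \<in> borel_measurable \<Omega>"
    unfolding T_def t_stat_def
    by (intro borel_measurable_Max fin borel_measurable_abs borel_measurable_divide Pm) auto
  define C where "C = posi_const \<Omega> H V\<beta> \<M> \<alpha> \<beta> \<beta>hat"
  have C_eq: "C = (LEAST c. 1 - \<alpha> \<le> prob {\<omega> \<in> space \<Omega>. T \<omega> \<le> c})"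
    unfolding C_def posi_const_def T_def ..
  have "1 - \<alpha> \<le> prob {\<omega> \<in> space \<Omega>. T \<omega> \<le> C}"
    unfolding C_eq using \<open>0 < \<alpha>\<close> \<open>\<alpha> < 1\<close>
    by (intro prob_le_Least_quantile \<open>T \<in> borel_measurable \<Omega>\<close>) simp_all
  also have "\<dots> \<le> prob {\<omega> \<in> space \<Omega>.
      surrogate H V\<beta> (Mhat (\<beta>hat \<omega>)) \<beta> \<in> CR_posi H V\<beta> Mhat C (\<beta>hat \<omega>)}" (is "_ \<le> prob ?E")
  proof (rule finite_measure_mono)
    \<comment> \<open>Monotonicity of the measure requires the larger event to be measurable.
      \<open>A M\<close> is the coverage event with the model frozen at \<open>M\<close>, which
      involves finitely many measurable conditions.\<close>
    define A where "A = (\<lambda>M. {\<omega> \<in> space \<Omega>. \<forall>h\<in>{..<H}.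
      \<bar>(P_mat H V\<beta> M *\<^sub>v (\<beta>hat \<omega> - \<beta>)) $ h\<bar> \<le> C * sqrt (V_M H V\<beta> M $$ (h, h))})"
    have cover: "surrogate H V\<beta> (Mhat (\<beta>hat \<omega>)) \<beta> \<in> CR_posi H V\<beta> Mhat C (\<beta>hat \<omega>)
        \<longleftrightarrow> \<omega> \<in> A (Mhat (\<beta>hat \<omega>))" if "\<omega> \<in> space \<Omega>" for \<omega>
      using surrogate_mem_CR_posi_iff[of H V\<beta> Mhat "\<beta>hat \<omega>" \<beta> C] P selin carr \<beta> that
      by (simp add: A_def Ball_def)
    have "A M \<in> sets \<Omega>" if "M \<in> \<M>" for M
      unfolding A_def
      by (intro sets.sets_Collect_finite_All borel_measurable_le borel_measurable_abs Pm that) auto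
    moreover have "{\<omega> \<in> space \<Omega>. Mhat (\<beta>hat \<omega>) = M} \<in> sets \<Omega>" if "M \<in> \<M>" for M
      using measurable_sets[OF sel, of "{M}"] that by (simp add: vimage_def Int_def conj_commute)
    \<comment> \<open>The random model is handled by splitting the coverage event according to its
      value: on each of the finitely many pieces the model is a constant.\<close>
    ultimately have "(\<Union>M\<in>\<M>. {\<omega> \<in> space \<Omega>. Mhat (\<beta>hat \<omega>) = M} \<inter> A M) \<in> sets \<Omega>"
      using fin by (intro sets.finite_UN sets.Int) auto
    also have "(\<Union>M\<in>\<M>. {\<omega> \<in> space \<Omega>. Mhat (\<beta>hat \<omega>) = M} \<inter> A M) = ?E"
      using cover selin by auto
    finally show "?E \<in> sets \<Omega>" .
    show "{\<omega> \<in> space \<Omega>. T \<omega> \<le> C} \<subseteq> ?E"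
    proof (intro subsetI CollectI conjI; clarify)
      fix \<omega> assume \<omega>: "\<omega> \<in> space \<Omega>" and T: "T \<omega> \<le> C"
      let ?M = "Mhat (\<beta>hat \<omega>)"
      \<comment> \<open>The selected model is a member of \<M> at every \<omega>, so its statistics
        are among those maximised in \<open>T\<close>, however it depends on the data.\<close>
      have "\<bar>t_stat H V\<beta> \<beta> (\<beta>hat \<omega>) ?M h\<bar> \<le> C" if "h < H" for h
      proof -
        have "\<bar>t_stat H V\<beta> \<beta> (\<beta>hat \<omega>) ?M h\<bar> \<le> (MAX h\<in>{..<H}. \<bar>t_stat H V\<beta> \<beta> (\<beta>hat \<omega>) ?M h\<bar>)"
          using that by (intro Max_ge) auto
        also have "\<dots> \<le> T \<omega>"
          unfolding T_def using fin selin[OF \<omega>] by (intro Max_ge) auto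
        finally show ?thesis using T by simp
      qed
      then have "\<omega> \<in> A ?M"
        using \<omega> abs_le_mult_sqrt_V_M[OF V P[OF selin[OF \<omega>]] carr[OF \<omega>] \<beta>] by (simp add: A_def Ball_def)
      then show "surrogate H V\<beta> ?M \<beta> \<in> CR_posi H V\<beta> Mhat C (\<beta>hat \<omega>)"
        using cover[OF \<omega>] by simp
    qed
  qed
  finally show ?thesis unfolding C_def .
qed

end
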